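(* Let $h$ be a positive integer and let $A$ be a finite set of $k$ positive integers. Then \[|h_{\pm}A| \geq 2(hk-h+1).\] Moreover, this lower bound is best possible for $h\leq 2$: for $h\in\{1,2\}$ and every positive integer $k$ there exists a set $A$ of $k$ positive integers with $|h_{\pm}A| = 2(hk-h+1)$ (for $h=1$ every such $A$ attains it, and for $h=2$ the set $A=\{1,3,5,\ldots,2k-1\}$ attains it).
   Context: For a finite set $A=\{a_0,a_1,\ldots,a_{k-1}\}$ of integers and a positive integer $h$, the $h$-fold signed sumset of $A$ is \[h_{\pm}A=\Big\{\sum_{i=0}^{k-1}\lambda_i a_i : (\lambda_0,\ldots,\lambda_{k-1})\in\mathbb{Z}^k,\ \sum_{i=0}^{k-1}|\lambda_i|=h\Big\}.\] *)

theory Defs imports Main begin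

definition signed_sumset :: "nat \<Rightarrow> int set \<Rightarrow> int set" where
  "signed_sumset h A = {(\<Sum>a\<in>A. l a * a) | l :: int \<Rightarrow> int. (\<Sum>a\<in>A. \<bar>l a\<bar>) = int h}"

end

theory Submission imports Defs begin

text \<open>
  Order \<open>A\<close> as \<open>a\<^sub>0 < \<dots> < a\<^sub>k\<^sub>-\<^sub>1\<close>. Replacing the summands \<open>a\<^sub>i\<close> of \<open>h a\<^sub>i\<close> one at a time by \<open>a\<^sub>i\<^sub>+\<^sub>1\<close> gives
  the increasing chain \<open>h a\<^sub>i < (h - 1) a\<^sub>i + a\<^sub>i\<^sub>+\<^sub>1 < \<dots> < h a\<^sub>i\<^sub>+\<^sub>1\<close>; concatenating these chains yields
  \<open>h (k - 1) + 1\<close> positive elements of the sumset, and their negatives are as many again.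
  For \<open>A = {1, 3, \<dots>, 2 k - 1}\<close> and \<open>h = 2\<close> every signed sum is even, nonzero and at most \<open>4 k - 2\<close> in
  absolute value, which leaves exactly \<open>2 (2 k - 1)\<close> values.
\<close>

section \<open>Basic properties of signed sumsets\<close>

lemma signed_sumsetI:
  assumes "(\<Sum>a\<in>A. \<bar>l a\<bar>) = int h" "x = (\<Sum>a\<in>A. l a * a)"
  shows "x \<in> signed_sumset h A"
  using assms unfolding signed_sumset_def by blast

lemma signed_sumsetE:
  assumes "x \<in> signed_sumset h A"
  obtains l where "(\<Sum>a\<in>A. \<bar>l a\<bar>) = int h" "x = (\<Sum>a\<in>A. l a * a)"
  using assms unfolding signed_sumset_def by blast

lemma signed_sumset_uminus:
  assumes "x \<in> signed_sumset h A"
  shows "- x \<in> signed_sumset h A"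
proof -
  obtain l where "(\<Sum>a\<in>A. \<bar>l a\<bar>) = int h" "x = (\<Sum>a\<in>A. l a * a)"
    using assms by (rule signed_sumsetE)
  then show ?thesis
    by (intro signed_sumsetI[where l = "\<lambda>a. - l a"]) (auto simp: sum_negf)
qed

text \<open>Coefficients on \<open>B\<close> extend by zero to \<open>A\<close>. This lets sums
  supported on one or two elements be built in \<open>{a}\<close> or \<open>{a, b}\<close> and then
  transferred to \<open>A\<close>.\<close>

lemma signed_sumset_mono:
  assumes "finite A" "B \<subseteq> A"
  shows "signed_sumset h B \<subseteq> signed_sumset h A"
proof
  fix x assume "x \<in> signed_sumset h B"
  then obtain l where l: "(\<Sum>a\<in>B. \<bar>l a\<bar>) = int h" "x = (\<Sum>a\<in>B. l a * a)"
    by (rule signed_sumsetE)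
  let ?l = "\<lambda>a. if a \<in> B then l a else 0"
  have "(\<Sum>a\<in>A. \<bar>?l a\<bar>) = (\<Sum>a\<in>B. \<bar>l a\<bar>)"
    using assms by (intro sum.mono_neutral_cong_right) auto
  moreover have "(\<Sum>a\<in>A. ?l a * a) = (\<Sum>a\<in>B. l a * a)"
    using assms by (intro sum.mono_neutral_cong_right) auto
  ultimately show "x \<in> signed_sumset h A"
    using l by (intro signed_sumsetI[where l = ?l]) auto
qed

lemma signed_sumset_abs_le:
  assumes "x \<in> signed_sumset h A" "\<And>a. a \<in> A \<Longrightarrow> \<bar>a\<bar> \<le> M"
  shows "\<bar>x\<bar> \<le> int h * M"
proof -
  obtain l where l: "(\<Sum>a\<in>A. \<bar>l a\<bar>) = int h" "x = (\<Sum>a\<in>A. l a * a)"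
    using assms(1) by (rule signed_sumsetE)
  have "\<bar>x\<bar> \<le> (\<Sum>a\<in>A. \<bar>l a * a\<bar>)"
    unfolding l by (rule sum_abs)
  also have "\<dots> \<le> (\<Sum>a\<in>A. \<bar>l a\<bar> * M)"
    using assms(2) by (intro sum_mono) (auto simp: abs_mult intro: mult_left_mono)
  also have "\<dots> = int h * M"
    by (simp add: l(1) flip: sum_distrib_right)
  finally show ?thesis .
qed

lemma finite_signed_sumset:
  assumes "finite A"
  shows "finite (signed_sumset h A)"
proof (rule finite_subset)
  \<comment> \<open>A sum of absolute values bounds every element and also makes sense for empty
    \<open>A\<close>, where \<open>Max\<close> is unspecified.\<close>
  define M where "M = (\<Sum>a\<in>A. \<bar>a\<bar>)"
  have M: "\<bar>a\<bar> \<le> M" if "a \<in> A" for a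
    unfolding M_def using that assms by (intro member_le_sum) auto
  show "signed_sumset h A \<subseteq> {- (int h * M)..int h * M}"
    using signed_sumset_abs_le[OF _ M] by fastforce
qed simp

lemma signed_sumset_pairI:
  assumes "finite A" "a \<in> A" "b \<in> A" "a \<noteq> b" "\<bar>i\<bar> + \<bar>j\<bar> = int h"
  shows "i * a + j * b \<in> signed_sumset h A"
proof -
  have "i * a + j * b \<in> signed_sumset h {a, b}"
    using assms by (intro signed_sumsetI[where l = "\<lambda>c. if c = a then i else j"]) auto
  then show ?thesis
    using signed_sumset_mono[of A "{a, b}"] assms by auto
qed

lemma signed_sumset_singleI:
  assumes "finite A" "a \<in> A" "\<bar>i\<bar> = int h"
  shows "i * a \<in> signed_sumset h A"
proof -
  have "i * a \<in> signed_sumset h {a}"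
    using assms by (intro signed_sumsetI[where l = "\<lambda>_. i"]) auto
  then show ?thesis
    using signed_sumset_mono[of A "{a}"] assms by auto
qed

section \<open>Splitting off a summand, small \<open>h\<close>, and parity\<close>

lemma signed_sumset_zero:
  assumes "finite A"
  shows "signed_sumset 0 A \<subseteq> {0}"
  using assms by (auto simp: signed_sumset_def sum_nonneg_eq_0_iff)

text \<open>As \<open>h > 0\<close>, some coefficient is nonzero; removing its element leaves a
  signed sum of strictly smaller order. Repeating this reduces orders 1 and 2 to order 0.\<close>

lemma signed_sumset_peel:
  assumes "finite A" "x \<in> signed_sumset h A" "h > 0"
  obtains a i y where "a \<in> A" "i \<noteq> 0" "nat \<bar>i\<bar> \<le> h" "x = i * a + y"
    "y \<in> signed_sumset (h - nat \<bar>i\<bar>) (A - {a})"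
proof -
  obtain l where l: "(\<Sum>a\<in>A. \<bar>l a\<bar>) = int h" "x = (\<Sum>a\<in>A. l a * a)"
    using assms(2) by (rule signed_sumsetE)
  obtain a where a: "a \<in> A" "l a \<noteq> 0"
    using l(1) assms(3) by (metis abs_zero of_nat_0_less_iff less_irrefl sum.neutral)
  have s: "int h = \<bar>l a\<bar> + (\<Sum>a\<in>A - {a}. \<bar>l a\<bar>)"
    using l(1) a assms(1) by (simp add: sum.remove)
  moreover have "(\<Sum>a\<in>A - {a}. \<bar>l a\<bar>) \<ge> 0"
    by (simp add: sum_nonneg)
  ultimately have le: "nat \<bar>l a\<bar> \<le> h"
    by linarith
  show thesis
  proof (rule that[of a "l a" "\<Sum>a\<in>A - {a}. l a * a"])
    show "x = l a * a + (\<Sum>a\<in>A - {a}. l a * a)"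
      using l(2) a assms(1) by (simp add: sum.remove)
    show "(\<Sum>a\<in>A - {a}. l a * a) \<in> signed_sumset (h - nat \<bar>l a\<bar>) (A - {a})"
      using s le by (intro signed_sumsetI[where l = l]) (auto simp: of_nat_diff)
  qed (use a le in auto)
qed

lemma signed_sumset_one:
  assumes "finite A"
  shows "signed_sumset 1 A = A \<union> uminus ` A"
proof (intro equalityI subsetI)
  fix x assume "x \<in> signed_sumset 1 A"
  then obtain a i y where *: "a \<in> A" "i \<noteq> 0" "nat \<bar>i\<bar> \<le> 1" "x = i * a + y"
    "y \<in> signed_sumset (1 - nat \<bar>i\<bar>) (A - {a})"
    using signed_sumset_peel[OF assms, of x 1] by auto
  then have "i = 1 \<or> i = - 1"
    by linarith
  moreover from this have "y = 0"
    using *(5) signed_sumset_zero[of "A - {a}"] assms by auto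
  ultimately show "x \<in> A \<union> uminus ` A"
    using * by auto
next
  fix x assume "x \<in> A \<union> uminus ` A"
  then show "x \<in> signed_sumset 1 A"
    using signed_sumset_singleI[OF assms, of _ 1 1] signed_sumset_singleI[OF assms, of _ "- 1" 1]
    by auto
qed

text \<open>The total weight 2 falls either on one element, giving plus or minus
  \<open>2 * a\<close>, or on two distinct ones, giving plus or minus \<open>a\<close> plus or minus
  \<open>b\<close>. Positivity and \<open>a \<noteq> b\<close> prevent cancellation.\<close>

lemma zero_notin_signed_sumset_two:
  assumes "finite A" "\<And>a. a \<in> A \<Longrightarrow> a > 0"
  shows "0 \<notin> signed_sumset 2 A"
proof
  assume "0 \<in> signed_sumset 2 A"
  then obtain a i y where *: "a \<in> A" "i \<noteq> 0" "nat \<bar>i\<bar> \<le> 2" "0 = i * a + y"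
    "y \<in> signed_sumset (2 - nat \<bar>i\<bar>) (A - {a})"
    using signed_sumset_peel[OF assms(1), of 0 2] by auto
  have fin: "finite (A - {a})"
    using assms(1) by simp
  consider "\<bar>i\<bar> = 2" | "i = 1 \<or> i = - 1"
    using * by linarith
  then show False
  proof cases
    case 1
    then have "y = 0"
      using *(5) signed_sumset_zero[OF fin] by auto
    then show False
      using * assms(2)[of a] by auto
  next
    case 2
    then have "nat \<bar>i\<bar> = 1"
      by auto
    then have "y \<in> signed_sumset 1 (A - {a})"
      using *(5) by simp
    then obtain b where "b \<in> A - {a}" "y = b \<or> y = - b"
      unfolding signed_sumset_one[OF fin] by auto
    then show False
      using 2 *(1,4) assms(2)[of a] assms(2)[of b] by auto
  qed
qed

text \<open>For odd \<open>a\<close>, the product \<open>l a * a\<close> has the parity of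
  \<open>l a\<close>, hence of \<open>\<bar>l a\<bar>\<close>. Summing gives \<open>x\<close>
  congruent to \<open>h\<close> modulo 2.\<close>

lemma even_signed_sum_iff:
  assumes "x \<in> signed_sumset h A" "\<And>a. a \<in> A \<Longrightarrow> odd a"
  shows "even x \<longleftrightarrow> even h"
proof -
  obtain l where l: "(\<Sum>a\<in>A. \<bar>l a\<bar>) = int h" "x = (\<Sum>a\<in>A. l a * a)"
    using assms(1) by (rule signed_sumsetE)
  have "even (\<Sum>a\<in>A. l a * a - \<bar>l a\<bar>)"
    using assms(2) by (intro dvd_sum) auto
  then have "even (x - int h)"
    by (simp add: l sum_subtractf)
  then show ?thesis
    by simp
qed

section \<open>The lower bound\<close>

lemma positive_signed_sums:
  assumes "finite A" "A \<noteq> {}" "\<forall>a\<in>A. a > 0" "h > 0"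
  shows "\<exists>P \<subseteq> signed_sumset h A. P \<subseteq> {0<..int h * Max A} \<and> card P = h * (card A - 1) + 1"
  using assms(1-3)
\<comment> \<open>Elements are added in increasing order. The bound \<open>int h * Max A\<close> is
  part of the claim so that the sums gained from a new maximum lie above all earlier ones.\<close>
proof (induction rule: finite_linorder_max_induct)
  case empty
  then show ?case by simp
next
  case (insert m B)
  show ?case
  proof (cases "B = {}")
    case True
    have "int h * m \<in> signed_sumset h {m}"
      by (rule signed_sumset_singleI) auto
    then show ?thesis
      using True insert.prems \<open>h > 0\<close>
      by (intro exI[of _ "{int h * m}"]) auto
  next
    case False
    define b where "b = Max B"
    have b: "b \<in> B" "b < m" "0 < b"
      using False insert by (auto simp: b_def)
    obtain P where P: "P \<subseteq> signed_sumset h B" "P \<subseteq> {0<..int h * b}" "card P = h * (card B - 1) + 1"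
      using insert False b_def by auto
    \<comment> \<open>\<open>f j\<close> exchanges \<open>j\<close> of the \<open>h\<close> copies
      of \<open>b\<close> for \<open>m\<close>. The index 0 is left out below, since
      \<open>f 0 = int h * b\<close> lies in the range reserved for \<open>P\<close>.\<close>
    define f where "f j = (int h - int j) * b + int j * m" for j
    \<comment> \<open>An arithmetic progression with positive difference \<open>m - b\<close>:
      injectivity and both bounds can be read off.\<close>
    have f_eq: "f j = int h * b + int j * (m - b)" for j
      by (simp add: f_def algebra_simps)
    have "inj_on f {1..h}"
      using b by (auto simp: inj_on_def f_eq)
    then have cardf: "card (f ` {1..h}) = h"
      by (simp add: card_image)
    have f_in: "f j \<in> signed_sumset h (insert m B)" if "j \<in> {1..h}" for j
      unfolding f_def using that b insert.hyps by (intro signed_sumset_pairI) auto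
    have f_gt: "f j > int h * b" if "j \<in> {1..h}" for j
      using that b by (auto simp: f_eq)
    have f_le: "f j \<le> int h * m" if "j \<in> {1..h}" for j
    proof -
      have "int j * (m - b) \<le> int h * (m - b)"
        using that b by (intro mult_right_mono) auto
      then show ?thesis
        by (simp add: f_eq algebra_simps)
    qed
    have Max: "Max (insert m B) = m"
      using insert.hyps by (intro Max_eqI) (auto intro: less_imp_le)
    have hb: "0 \<le> int h * b" "int h * b \<le> int h * m"
      using b by (auto intro: mult_left_mono)
    have "finite P"
      using P(2) finite_subset by blast
    moreover have "P \<inter> f ` {1..h} = {}"
      using P(2) f_gt by fastforce
    ultimately have "card (P \<union> f ` {1..h}) = h * (card B - 1) + 1 + h"
      using P(3) cardf by (simp add: card_Un_disjoint)
    also have "\<dots> = h * (card (insert m B) - 1) + 1"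
    proof -
      \<comment> \<open>With \<open>B\<close> nonempty, \<open>card B - 1\<close> is not truncated,
        so one more element contributes exactly \<open>h\<close>.\<close>
      have "m \<notin> B" "card B > 0"
        using insert.hyps False by (auto simp: card_gt_0_iff)
      then show ?thesis
        using insert.hyps by (cases "card B") auto
    qed
    finally have "card (P \<union> f ` {1..h}) = h * (card (insert m B) - 1) + 1" .
    moreover have "P \<union> f ` {1..h} \<subseteq> signed_sumset h (insert m B)"
      using P(1) f_in signed_sumset_mono[of "insert m B" B h] insert.hyps by blast
    moreover have "P \<union> f ` {1..h} \<subseteq> {0<..int h * Max (insert m B)}"
      using P(2) f_gt f_le hb unfolding Max by fastforce
    ultimately show ?thesis
      by blast
  qed
qed

text \<open>A set of positive integers is disjoint from its mirror image, and negation is injective.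
  This supplies the factor 2 in the lower bound and in the exact counts.\<close>

lemma card_Un_uminus_positive:
  assumes "finite (P :: int set)" "\<And>x. x \<in> P \<Longrightarrow> x > 0"
  shows "card (P \<union> uminus ` P) = 2 * card P"
proof -
  have "- x \<notin> P" if "x \<in> P" for x
    using assms(2)[OF that] assms(2)[of "- x"] by auto
  then have "P \<inter> uminus ` P = {}"
    by auto
  then show ?thesis
    using assms(1) by (simp add: card_Un_disjoint card_image)
qed

lemma card_signed_sumset_ge:
  assumes "h > 0" "finite A" "\<forall>a\<in>A. a > 0"
  shows "int (card (signed_sumset h A)) \<ge> 2 * (int h * int (card A) - int h + 1)"
proof (cases "A = {}")
  \<comment> \<open>The right-hand side is \<open>2 * (1 - int h)\<close>, which is at most
    0.\<close>
  case True
  then show ?thesis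
    using assms(1) by simp
next
  case False
  obtain P where P: "P \<subseteq> signed_sumset h A" "P \<subseteq> {0<..int h * Max A}" "card P = h * (card A - 1) + 1"
    using positive_signed_sums[OF assms(2) False assms(3,1)] by blast
  have "2 * card P = card (P \<union> uminus ` P)"
    using P(2) finite_subset by (intro card_Un_uminus_positive[symmetric]) auto
  also have "\<dots> \<le> card (signed_sumset h A)"
    using P(1) signed_sumset_uminus assms(2)
    by (intro card_mono finite_signed_sumset) auto
  finally have "2 * int (card P) \<le> int (card (signed_sumset h A))"
    by linarith
  moreover have "card A > 0"
    using False assms(2) by (simp add: card_gt_0_iff)
  ultimately show ?thesis
    by (simp add: P(3) of_nat_diff algebra_simps)
qed

section \<open>Sharpness for \<open>h = 1\<close> and \<open>h = 2\<close>\<close>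

lemma card_signed_sumset_one:
  assumes "finite A" "\<forall>a\<in>A. a > 0"
  shows "card (signed_sumset 1 A) = 2 * card A"
  using card_Un_uminus_positive[of A] signed_sumset_one assms by simp

lemma odd_numbers_eq:
  "{2 * int i - 1 | i::nat. 1 \<le> i \<and> i \<le> k} = (\<lambda>i. 2 * int i - 1) ` {1..k}"
  by auto

lemma card_odd_numbers: "card {2 * int i - 1 | i::nat. 1 \<le> i \<and> i \<le> k} = k"
  unfolding odd_numbers_eq by (subst card_image) (auto simp: inj_on_def)

lemma odd_numbers_iff:
  "a \<in> {2 * int i - 1 | i::nat. 1 \<le> i \<and> i \<le> k} \<longleftrightarrow> odd a \<and> 0 < a \<and> a \<le> 2 * int k - 1"
proof
  assume r: "odd a \<and> 0 < a \<and> a \<le> 2 * int k - 1"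
  then obtain c where c: "a = 2 * c + 1"
    by (auto elim: oddE)
  have "a = 2 * int (nat (c + 1)) - 1 \<and> 1 \<le> nat (c + 1) \<and> nat (c + 1) \<le> k"
    using r c by auto
  then show "a \<in> {2 * int i - 1 | i::nat. 1 \<le> i \<and> i \<le> k}"
    by blast
qed auto

text \<open>Parity, the absolute bound and the absence of 0 give one inclusion. Conversely,
  \<open>2 * m\<close> is \<open>m + m\<close> for odd \<open>m\<close> and
  \<open>(m - 1) + (m + 1)\<close> for even \<open>m\<close>; negatives follow by symmetry.\<close>

lemma signed_sumset_two_odd_numbers:
  fixes k :: nat
  defines "A \<equiv> {2 * int i - 1 | i::nat. 1 \<le> i \<and> i \<le> k}"
  defines "P \<equiv> (\<lambda>m. 2 * m) ` {1..2 * int k - 1}"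
  shows "signed_sumset 2 A = P \<union> uminus ` P"
proof (intro equalityI subsetI)
  have fin: "finite A"
    unfolding A_def odd_numbers_eq by simp
  have A: "a \<in> A \<longleftrightarrow> odd a \<and> 0 < a \<and> a \<le> 2 * int k - 1" for a
    unfolding A_def by (rule odd_numbers_iff)
  {
    fix x assume x: "x \<in> signed_sumset 2 A"
    have "even x"
      using even_signed_sum_iff[OF x] A by simp
    then obtain m where m: "x = 2 * m"
      by (elim evenE)
    have "\<bar>x\<bar> \<le> int 2 * (2 * int k - 1)"
      by (rule signed_sumset_abs_le[OF x]) (auto simp: A)
    moreover have "x \<noteq> 0"
      using x zero_notin_signed_sumset_two[OF fin] A by auto
    ultimately have "m \<in> {1..2 * int k - 1} \<or> - m \<in> {1..2 * int k - 1}"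
      using m by auto
    then show "x \<in> P \<union> uminus ` P"
    proof
      assume "- m \<in> {1..2 * int k - 1}"
      then have "- x \<in> P"
        unfolding P_def m by (intro image_eqI[of _ _ "- m"]) auto
      then show ?thesis
        by (intro UnI2 image_eqI[of _ _ "- x"]) auto
    qed (auto simp: P_def m)
  }
  have P: "x \<in> signed_sumset 2 A" if "x \<in> P" for x
  proof -
    obtain m where m: "x = 2 * m" "1 \<le> m" "m \<le> 2 * int k - 1"
      using \<open>x \<in> P\<close> unfolding P_def by auto
    show ?thesis
    proof (cases "even m")
      case True
      \<comment> \<open>Both endpoints are odd, so an even \<open>m\<close> lies strictly between
        them and its odd neighbours \<open>m - 1\<close> and \<open>m + 1\<close> belong to
        \<open>A\<close>.\<close>
      then have "m \<noteq> 1" "m \<noteq> 2 * int k - 1"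
        by auto
      then have "1 * (m - 1) + 1 * (m + 1) \<in> signed_sumset 2 A"
        using fin m True by (intro signed_sumset_pairI) (auto simp: A)
      then show ?thesis
        by (simp add: m)
    next
      case False
      then show ?thesis
        using fin m signed_sumset_singleI[of A m 2 2] by (simp add: A)
    qed
  qed
  fix x assume "x \<in> P \<union> uminus ` P"
  then show "x \<in> signed_sumset 2 A"
    using P signed_sumset_uminus by auto
qed

lemma card_signed_sumset_two_odd_numbers:
  assumes "k > 0"
  shows "int (card (signed_sumset 2 {2 * int i - 1 | i::nat. 1 \<le> i \<and> i \<le> k})) = 2 * (2 * int k - 1)"
proof -
  let ?P = "(\<lambda>m::int. 2 * m) ` {1..2 * int k - 1}"
  have "card (?P \<union> uminus ` ?P) = 2 * card ?P"
    by (rule card_Un_uminus_positive) auto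
  also have "card ?P = nat (2 * int k - 1)"
    by (subst card_image) (auto simp: inj_on_def)
  \<comment> \<open>As \<open>k > 0\<close>, \<open>2 * int k - 1\<close> is positive and
    \<open>nat\<close> preserves its value.\<close>
  finally show ?thesis
    unfolding signed_sumset_two_odd_numbers using assms by simp
qed

theorem theorem1:
  "(\<forall>(h::nat) (k::nat) (A::int set).
      h > 0 \<longrightarrow> finite A \<longrightarrow> card A = k \<longrightarrow> (\<forall>a\<in>A. a > 0) \<longrightarrow>
      int (card (signed_sumset h A)) \<ge> 2 * (int h * int k - int h + 1))
   \<and> (\<forall>h\<in>{1, 2::nat}. \<forall>k::nat. k > 0 \<longrightarrow>
      (\<exists>A::int set. finite A \<and> card A = k \<and> (\<forall>a\<in>A. a > 0) \<and>
         int (card (signed_sumset h A)) = 2 * (int h * int k - int h + 1)))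
   \<and> (\<forall>(k::nat) (A::int set).
      k > 0 \<longrightarrow> finite A \<longrightarrow> card A = k \<longrightarrow> (\<forall>a\<in>A. a > 0) \<longrightarrow>
      int (card (signed_sumset 1 A)) = 2 * (1 * int k - 1 + 1))
   \<and> (\<forall>k::nat. k > 0 \<longrightarrow>
      card {2 * int i - 1 | i::nat. 1 \<le> i \<and> i \<le> k} = k \<and>
      int (card (signed_sumset 2 {2 * int i - 1 | i::nat. 1 \<le> i \<and> i \<le> k}))
        = 2 * (2 * int k - 2 + 1))"
proof (intro conjI)
  show "\<forall>h\<in>{1, 2::nat}. \<forall>k::nat. k > 0 \<longrightarrow>
      (\<exists>A::int set. finite A \<and> card A = k \<and> (\<forall>a\<in>A. a > 0) \<and>
         int (card (signed_sumset h A)) = 2 * (int h * int k - int h + 1))"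
  proof (intro ballI allI impI)
    fix h k :: nat assume h: "h \<in> {1, 2}" and k: "k > 0"
    \<comment> \<open>The same set of odd numbers witnesses both orders.\<close>
    let ?A = "{2 * int i - 1 | i::nat. 1 \<le> i \<and> i \<le> k}"
    have fin: "finite ?A"
      unfolding odd_numbers_eq by simp
    have pos: "\<forall>a\<in>?A. a > 0"
      using odd_numbers_iff by blast
    have "int (card (signed_sumset h ?A)) = 2 * (int h * int k - int h + 1)"
    proof (cases "h = 1")
      case True
      then show ?thesis
        using card_signed_sumset_one[OF fin pos] unfolding card_odd_numbers by simp
    next
      case False
      then have "h = 2"
        using h by simp
      then show ?thesis
        using card_signed_sumset_two_odd_numbers[OF k] by simp
    qed
    then show "\<exists>A::int set. finite A \<and> card A = k \<and> (\<forall>a\<in>A. a > 0) \<and>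
        int (card (signed_sumset h A)) = 2 * (int h * int k - int h + 1)"
      using fin pos card_odd_numbers[of k] by blast
  qed
qed (use card_signed_sumset_ge card_signed_sumset_one card_odd_numbers
    card_signed_sumset_two_odd_numbers in simp_all)

end
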